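(* Let $\mu$ be a measurable cardinal and let $\phi$ be a sentence of $L_{\mu,\mu}$ (in particular, $\phi$ may be any sentence of $L_{\omega_1,\omega}$). Then no model of $\phi$ of cardinality $\ge\mu$ is maximal.
   Context: A model $M$ of $\phi$ is maximal if there is no model $N$ of $\phi$ of which $M$ is a proper substructure. *)

theory Defs
  imports Main
begin

unbundle cardinal_syntax

record ('f, 'r) vocab =
  funs :: "'f set"
  rels :: "'r set"
  far :: "'f \<Rightarrow> nat"
  rar :: "'r \<Rightarrow> nat"

datatype ('f, 'v) trm = Var 'v | App 'f "('f, 'v) trm list"

text \<open>
  \<open>Conj I F\<close> is the conjunction of the family \<open>F i\<close>, \<open>i \<in> I\<close> (the values of \<open>F\<close> outside \<open>I\<close> are
  irrelevant throughout), and \<open>Exists X \<phi>\<close> quantifies simultaneously over all variables in \<open>X\<close>.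
  The types \<open>'i\<close> and \<open>'v\<close> of indices and of variables are arbitrary; the cardinality bounds of
  \<open>L\<^sub>\<kappa>\<^sub>\<nu>\<close> are imposed by \<open>in_L\<close>.
\<close>

datatype ('f, 'r, 'i, 'v) fml =
    Eq "('f, 'v) trm" "('f, 'v) trm"
  | Rel 'r "('f, 'v) trm list"
  | Neg "('f, 'r, 'i, 'v) fml"
  | Conj "'i set" "'i \<Rightarrow> ('f, 'r, 'i, 'v) fml"
  | Exists "'v set" "('f, 'r, 'i, 'v) fml"

primrec wf_trm :: "('f, 'r) vocab \<Rightarrow> ('f, 'v) trm \<Rightarrow> bool" where
  "wf_trm V (Var x) \<longleftrightarrow> True"
| "wf_trm V (App f ts) \<longleftrightarrow> f \<in> funs V \<and> length ts = far V f \<and> list_all (wf_trm V) ts"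

primrec in_L :: "('f, 'r) vocab \<Rightarrow> 'k rel \<Rightarrow> 'l rel \<Rightarrow> ('f, 'r, 'i, 'v) fml \<Rightarrow> bool" where
  "in_L V \<kappa> \<nu> (Eq t u) \<longleftrightarrow> wf_trm V t \<and> wf_trm V u"
| "in_L V \<kappa> \<nu> (Rel r ts) \<longleftrightarrow> r \<in> rels V \<and> length ts = rar V r \<and> list_all (wf_trm V) ts"
| "in_L V \<kappa> \<nu> (Neg \<phi>) \<longleftrightarrow> in_L V \<kappa> \<nu> \<phi>"
| "in_L V \<kappa> \<nu> (Conj I F) \<longleftrightarrow> |I| <o \<kappa> \<and> (\<forall>i\<in>I. in_L V \<kappa> \<nu> (F i))"
| "in_L V \<kappa> \<nu> (Exists X \<phi>) \<longleftrightarrow> |X| <o \<nu> \<and> in_L V \<kappa> \<nu> \<phi>"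

primrec fv_trm :: "('f, 'v) trm \<Rightarrow> 'v set" where
  "fv_trm (Var x) = {x}"
| "fv_trm (App f ts) = \<Union> (set (map fv_trm ts))"

primrec fv :: "('f, 'r, 'i, 'v) fml \<Rightarrow> 'v set" where
  "fv (Eq t u) = fv_trm t \<union> fv_trm u"
| "fv (Rel r ts) = \<Union> (set (map fv_trm ts))"
| "fv (Neg \<phi>) = fv \<phi>"
| "fv (Conj I F) = (\<Union>i\<in>I. fv (F i))"
| "fv (Exists X \<phi>) = fv \<phi> - X"

definition sentence_L ::
  "('f, 'r) vocab \<Rightarrow> 'k rel \<Rightarrow> 'l rel \<Rightarrow> ('f, 'r, 'i, 'v) fml \<Rightarrow> bool" where
  "sentence_L V \<kappa> \<nu> \<phi> \<longleftrightarrow> in_L V \<kappa> \<nu> \<phi> \<and> fv \<phi> = {}"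

record ('f, 'r, 'a) struct =
  univ :: "'a set"
  fint :: "'f \<Rightarrow> 'a list \<Rightarrow> 'a"
  rint :: "'r \<Rightarrow> 'a list \<Rightarrow> bool"

definition is_struct :: "('f, 'r) vocab \<Rightarrow> ('f, 'r, 'a) struct \<Rightarrow> bool" where
  "is_struct V M \<longleftrightarrow> univ M \<noteq> {} \<and>
     (\<forall>f\<in>funs V. \<forall>xs\<in>lists (univ M). length xs = far V f \<longrightarrow> fint M f xs \<in> univ M)"

primrec eval_trm :: "('f, 'r, 'a) struct \<Rightarrow> ('v \<Rightarrow> 'a) \<Rightarrow> ('f, 'v) trm \<Rightarrow> 'a" where
  "eval_trm M s (Var x) = s x"
| "eval_trm M s (App f ts) = fint M f (map (eval_trm M s) ts)"

primrec sat :: "('f, 'r, 'a) struct \<Rightarrow> ('v \<Rightarrow> 'a) \<Rightarrow> ('f, 'r, 'i, 'v) fml \<Rightarrow> bool" where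
  "sat M s (Eq t u) \<longleftrightarrow> eval_trm M s t = eval_trm M s u"
| "sat M s (Rel r ts) \<longleftrightarrow> rint M r (map (eval_trm M s) ts)"
| "sat M s (Neg \<phi>) \<longleftrightarrow> \<not> sat M s \<phi>"
| "sat M s (Conj I F) \<longleftrightarrow> (\<forall>i\<in>I. sat M s (F i))"
| "sat M s (Exists X \<phi>) \<longleftrightarrow>
     (\<exists>s'. (\<forall>x\<in>X. s' x \<in> univ M) \<and> (\<forall>x. x \<notin> X \<longrightarrow> s' x = s x) \<and> sat M s' \<phi>)"

definition is_model ::
  "('f, 'r) vocab \<Rightarrow> ('f, 'r, 'i, 'v) fml \<Rightarrow> ('f, 'r, 'a) struct \<Rightarrow> bool" where
  "is_model V \<phi> M \<longleftrightarrow> is_struct V M \<and> (\<forall>s. range s \<subseteq> univ M \<longrightarrow> sat M s \<phi>)"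

definition substruct ::
  "('f, 'r) vocab \<Rightarrow> ('f, 'r, 'a) struct \<Rightarrow> ('f, 'r, 'a) struct \<Rightarrow> bool" where
  "substruct V M N \<longleftrightarrow> is_struct V M \<and> is_struct V N \<and> univ M \<subseteq> univ N \<and>
     (\<forall>f\<in>funs V. \<forall>xs\<in>lists (univ M). length xs = far V f \<longrightarrow> fint M f xs = fint N f xs) \<and>
     (\<forall>r\<in>rels V. \<forall>xs\<in>lists (univ M). length xs = rar V r \<longrightarrow> rint M r xs = rint N r xs)"

definition proper_substruct ::
  "('f, 'r) vocab \<Rightarrow> ('f, 'r, 'a) struct \<Rightarrow> ('f, 'r, 'a) struct \<Rightarrow> bool" where
  "proper_substruct V M N \<longleftrightarrow> substruct V M N \<and> univ M \<noteq> univ N"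

text \<open>
  The universe of a structure may exhaust the type \<open>'a\<close>, which then has no room for an extension.
  Extensions therefore live in \<open>'a + 'b\<close>, where \<open>M\<close> is identified with its isomorphic copy
  \<open>inl_copy M\<close> and \<open>'b\<close> provides fresh elements. Enlarging \<open>'b\<close> only makes maximality harder to
  satisfy, so failing to be maximal for one type \<open>'b\<close> means failing to be maximal outright.
\<close>

definition inl_copy :: "('f, 'r, 'a) struct \<Rightarrow> ('f, 'r, 'a + 'b) struct" where
  "inl_copy M = \<lparr>univ = Inl ` univ M,
                 fint = (\<lambda>f ys. Inl (fint M f (map projl ys))),
                 rint = (\<lambda>r ys. rint M r (map projl ys))\<rparr>"

definition maximal_model ::
  "'b itself \<Rightarrow> ('f, 'r) vocab \<Rightarrow> ('f, 'r, 'i, 'v) fml \<Rightarrow> ('f, 'r, 'a) struct \<Rightarrow> bool" where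
  "maximal_model (T :: 'b itself) V \<phi> M \<longleftrightarrow> is_model V \<phi> M \<and>
     \<not> (\<exists>N :: ('f, 'r, 'a + 'b) struct. is_model V \<phi> N \<and> proper_substruct V (inl_copy M) N)"

text \<open>A cardinal is represented, as in the library, by a cardinal well-order \<open>\<mu>\<close> of its field.\<close>

definition ultrafilter_on :: "'k set \<Rightarrow> 'k set set \<Rightarrow> bool" where
  "ultrafilter_on S U \<longleftrightarrow> U \<subseteq> Pow S \<and> S \<in> U \<and> {} \<notin> U \<and>
     (\<forall>X\<in>U. \<forall>Y. X \<subseteq> Y \<and> Y \<subseteq> S \<longrightarrow> Y \<in> U) \<and>
     (\<forall>X\<in>U. \<forall>Y\<in>U. X \<inter> Y \<in> U) \<and>
     (\<forall>X. X \<subseteq> S \<longrightarrow> X \<in> U \<or> S - X \<in> U)"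

definition nonprincipal_on :: "'k set \<Rightarrow> 'k set set \<Rightarrow> bool" where
  "nonprincipal_on S U \<longleftrightarrow> (\<forall>x\<in>S. {x} \<notin> U)"

definition complete_family :: "'k rel \<Rightarrow> 'k set set \<Rightarrow> bool" where
  "complete_family \<mu> U \<longleftrightarrow> (\<forall>A. A \<subseteq> U \<and> A \<noteq> {} \<and> |A| <o \<mu> \<longrightarrow> \<Inter> A \<in> U)"

definition measurable_cardinal :: "'k rel \<Rightarrow> bool" where
  "measurable_cardinal \<mu> \<longleftrightarrow> Card_order \<mu> \<and> natLeq <o \<mu> \<and>
     (\<exists>U. ultrafilter_on (Field \<mu>) U \<and> nonprincipal_on (Field \<mu>) U \<and> complete_family \<mu> U)"

end

theory Submission
  imports Defs
begin

text \<open>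
  The extension is the ultrapower of \<open>M\<close> by a \<open>\<mu>\<close>-complete nonprincipal ultrafilter \<open>U\<close> on \<open>\<mu>\<close>.
  \<open>\<mu>\<close>-completeness is exactly what the conjunction step of Los's theorem needs; the quantifier
  step works for blocks of variables of any size, since representatives are chosen for each
  variable separately. The diagonal embedding is proper because an injection of \<open>\<mu>\<close> into
  \<open>univ M\<close> is constant on no set in \<open>U\<close>.
\<close>

section \<open>An ultrafilter read as a quantifier\<close>

locale ultrafilter =
  fixes S :: "'k set" and U :: "'k set set"
  assumes ultra: "ultrafilter_on S U"
begin

text \<open>"For almost all \<open>k\<close>": as a quantifier, \<open>U\<close> commutes with each
  connective thanks to one of its closure properties.\<close>

definition often :: "('k \<Rightarrow> bool) \<Rightarrow> bool" where
  "often P \<longleftrightarrow> {k\<in>S. P k} \<in> U"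

lemma often_mono:
  assumes "often P" and "\<And>k. k \<in> S \<Longrightarrow> P k \<Longrightarrow> Q k"
  shows "often Q"
proof -
  have "{k\<in>S. P k} \<subseteq> {k\<in>S. Q k}" "{k\<in>S. Q k} \<subseteq> S"
    using assms(2) by auto
  then show ?thesis
    using assms(1) ultra unfolding often_def ultrafilter_on_def by blast
qed

lemma often_conj: "often (\<lambda>k. P k \<and> Q k) \<longleftrightarrow> often P \<and> often Q"
proof
  assume "often (\<lambda>k. P k \<and> Q k)"
  then show "often P \<and> often Q" by (auto elim: often_mono)
next
  assume "often P \<and> often Q"
  then have "{k\<in>S. P k} \<inter> {k\<in>S. Q k} \<in> U"
    using ultra unfolding often_def ultrafilter_on_def by blast
  also have "{k\<in>S. P k} \<inter> {k\<in>S. Q k} = {k\<in>S. P k \<and> Q k}" by auto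
  finally show "often (\<lambda>k. P k \<and> Q k)" by (simp add: often_def)
qed

lemma often_const [simp]: "often (\<lambda>k. P) \<longleftrightarrow> P"
  using ultra by (cases P) (auto simp: often_def ultrafilter_on_def)

lemma often_all: "(\<And>k. k \<in> S \<Longrightarrow> P k) \<Longrightarrow> often P"
  using often_mono[of "\<lambda>_. True" P] by simp

lemma often_ex:
  assumes "often P"
  shows "\<exists>k\<in>S. P k"
  \<comment> \<open>The goal does not mention the bound \<open>k\<close>, so once \<open>P\<close>
    is weakened to it, \<open>often_const\<close> strips the quantifier.\<close>
  using often_mono[OF assms, of "\<lambda>_. \<exists>k\<in>S. P k"] by auto

lemma often_not: "often (\<lambda>k. \<not> P k) \<longleftrightarrow> \<not> often P"
proof -
  have "often P \<or> often (\<lambda>k. \<not> P k)"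
  proof -
    have "S - {k\<in>S. P k} = {k\<in>S. \<not> P k}" by auto
    moreover have "{k\<in>S. P k} \<subseteq> S" by auto
    ultimately show ?thesis
      using ultra unfolding often_def ultrafilter_on_def by metis
  qed
  moreover have "\<not> (often P \<and> often (\<lambda>k. \<not> P k))"
    using often_conj[of P "\<lambda>k. \<not> P k"] by simp
  ultimately show ?thesis by blast
qed

lemma often_list: "(\<And>x. x \<in> set xs \<Longrightarrow> often (P x)) \<Longrightarrow> often (\<lambda>k. \<forall>x\<in>set xs. P x k)"
  by (induction xs) (auto simp: often_conj)

lemma often_ball:
  assumes "complete_family \<mu> U" and "|I| <o \<mu>"
  shows "often (\<lambda>k. \<forall>i\<in>I. P i k) \<longleftrightarrow> (\<forall>i\<in>I. often (P i))"
\<comment> \<open>\<open>complete_family\<close> speaks of nonempty families only; over the empty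
  \<open>I\<close> both sides are true.\<close>
proof (cases "I = {}")
  case False
  show ?thesis
  proof
    assume "often (\<lambda>k. \<forall>i\<in>I. P i k)"
    then show "\<forall>i\<in>I. often (P i)" by (auto elim: often_mono)
  next
    assume "\<forall>i\<in>I. often (P i)"
    moreover have "|(\<lambda>i. {k\<in>S. P i k}) ` I| <o \<mu>"
      using card_of_image assms(2) by (rule ordLeq_ordLess_trans)
    ultimately have "(\<Inter>i\<in>I. {k\<in>S. P i k}) \<in> U"
      using assms(1) False unfolding complete_family_def often_def
      by (elim allE[of _ "(\<lambda>i. {k\<in>S. P i k}) ` I"]) auto
    moreover have "(\<Inter>i\<in>I. {k\<in>S. P i k}) = {k\<in>S. \<forall>i\<in>I. P i k}"
      using False by auto
    ultimately show "often (\<lambda>k. \<forall>i\<in>I. P i k)" by (simp add: often_def)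
  qed
qed simp

section \<open>Classes modulo the ultrafilter\<close>

definition ueq :: "('k \<Rightarrow> 'a) \<Rightarrow> ('k \<Rightarrow> 'a) \<Rightarrow> bool" where
  "ueq f g \<longleftrightarrow> often (\<lambda>k. f k = g k)"

lemma ueq_refl: "ueq f f"
  by (simp add: ueq_def)

lemma ueq_sym: "ueq f g \<Longrightarrow> ueq g f"
  by (auto simp: ueq_def elim: often_mono)

lemma ueq_trans: "ueq f g \<Longrightarrow> ueq g h \<Longrightarrow> ueq f h"
  using often_conj[of "\<lambda>k. f k = g k" "\<lambda>k. g k = h k"]
  by (auto simp: ueq_def elim: often_mono)

text \<open>
  A class modulo \<open>U\<close> is encoded by \<open>Inl a\<close> if it contains the constant function \<open>a\<close>, and otherwise
  by \<open>Inr g\<close> for a chosen member \<open>g\<close>; so the diagonal embedding is literally \<open>Inl\<close>.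
\<close>

definition cls :: "('k \<Rightarrow> 'a) \<Rightarrow> 'a + ('k \<Rightarrow> 'a)" where
  "cls f = (if \<exists>a. ueq f (\<lambda>_. a) then Inl (SOME a. ueq f (\<lambda>_. a)) else Inr (SOME g. ueq f g))"

primrec rep :: "'a + ('k \<Rightarrow> 'a) \<Rightarrow> 'k \<Rightarrow> 'a" where
  "rep (Inl a) = (\<lambda>_. a)"
| "rep (Inr g) = g"

lemma ueq_rep_cls: "ueq f (rep (cls f))"
proof (cases "\<exists>a. ueq f (\<lambda>_. a)")
  case True
  then show ?thesis by (simp add: cls_def someI_ex[OF True])
next
  case False
  then show ?thesis by (auto simp: cls_def intro: someI[of "ueq f", OF ueq_refl])
qed

lemma cls_eq_iff: "cls f = cls g \<longleftrightarrow> ueq f g"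
proof
  assume "cls f = cls g"
  then show "ueq f g"
    using ueq_rep_cls[of f] ueq_rep_cls[of g] by (metis ueq_sym ueq_trans)
next
  assume "ueq f g"
  \<comment> \<open>\<open>cls f\<close> depends on \<open>f\<close> only through the predicate
    \<open>ueq f\<close>, so equal predicates yield the same choices.\<close>
  then have "ueq f = ueq g" by (intro ext) (metis ueq_sym ueq_trans)
  then show "cls f = cls g" by (simp add: cls_def)
qed

text \<open>A class contains at most one constant function, which leaves the choice in
  \<open>cls\<close> no freedom.\<close>

lemma cls_const [simp]: "cls (\<lambda>_. a) = Inl a"
proof -
  have "ueq (\<lambda>_. a) (\<lambda>_. b) \<longleftrightarrow> a = b" for b by (simp add: ueq_def)
  then show ?thesis by (simp add: cls_def)
qed

section \<open>The ultrapower and Los's theorem\<close>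

definition upower :: "('f, 'r, 'a) struct \<Rightarrow> ('f, 'r, 'a + ('k \<Rightarrow> 'a)) struct" where
  "upower M = \<lparr>univ = cls ` {f. range f \<subseteq> univ M},
               fint = (\<lambda>f ys. cls (\<lambda>k. fint M f (map (\<lambda>y. rep y k) ys))),
               rint = (\<lambda>r ys. often (\<lambda>k. rint M r (map (\<lambda>y. rep y k) ys)))\<rparr>"

text \<open>Argument lists are finite, so finite intersections suffice. This makes the operations
  and relations of \<open>upower M\<close> independent of representatives.\<close>

lemma often_map_rep: "often (\<lambda>k. map (\<lambda>y. rep y k) (map cls fs) = map (\<lambda>f. f k) fs)"
proof (rule often_mono)
  show "often (\<lambda>k. \<forall>f\<in>set fs. f k = rep (cls f) k)"
    using ueq_rep_cls unfolding ueq_def by (intro often_list) blast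
qed (auto simp: comp_def)

lemma fint_upower: "fint (upower M) f (map cls fs) = cls (\<lambda>k. fint M f (map (\<lambda>f. f k) fs))"
  unfolding upower_def struct.simps cls_eq_iff ueq_def
  by (rule often_mono[OF often_map_rep[of fs]]) (simp only:)

lemma rint_upower: "rint (upower M) r (map cls fs) \<longleftrightarrow> often (\<lambda>k. rint M r (map (\<lambda>f. f k) fs))"
  unfolding upower_def struct.simps
proof
  assume *: "often (\<lambda>k. rint M r (map (\<lambda>y. rep y k) (map cls fs)))"
  show "often (\<lambda>k. rint M r (map (\<lambda>f. f k) fs))"
    by (rule often_mono[OF iffD2[OF often_conj conjI[OF * often_map_rep[of fs]]]]) metis
next
  assume *: "often (\<lambda>k. rint M r (map (\<lambda>f. f k) fs))"
  show "often (\<lambda>k. rint M r (map (\<lambda>y. rep y k) (map cls fs)))"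
    by (rule often_mono[OF iffD2[OF often_conj conjI[OF * often_map_rep[of fs]]]]) metis
qed

lemma eval_upower:
  "eval_trm (upower M) (\<lambda>x. cls (\<sigma> x)) t = cls (\<lambda>k. eval_trm M (\<lambda>x. \<sigma> x k) t)"
proof (induction t)
  case (App f ts)
  have "map (eval_trm (upower M) (\<lambda>x. cls (\<sigma> x))) ts
      = map cls (map (\<lambda>t k. eval_trm M (\<lambda>x. \<sigma> x k) t) ts)"
    using App.IH by simp
  then have "eval_trm (upower M) (\<lambda>x. cls (\<sigma> x)) (App f ts)
      = fint (upower M) f (map cls (map (\<lambda>t k. eval_trm M (\<lambda>x. \<sigma> x k) t) ts))"
    by (simp only: eval_trm.simps)
  then show ?case by (simp only: fint_upower) (simp add: comp_def)
qed simp

text \<open>Induction on \<open>\<phi>\<close> for all \<open>\<sigma>\<close> at once, as the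
  quantifier step changes the assignment.\<close>

theorem Los:
  assumes "complete_family \<mu> U" and "in_L V \<mu> \<nu> \<phi>" and "\<And>x. range (\<sigma> x) \<subseteq> univ M"
  shows "sat (upower M) (\<lambda>x. cls (\<sigma> x)) \<phi> \<longleftrightarrow> often (\<lambda>k. sat M (\<lambda>x. \<sigma> x k) \<phi>)"
  using assms(2,3)
proof (induction \<phi> arbitrary: \<sigma>)
  case (Eq t u)
  then show ?case by (simp add: eval_upower cls_eq_iff ueq_def)
next
  case (Rel r ts)
  have "map (eval_trm (upower M) (\<lambda>x. cls (\<sigma> x))) ts
      = map cls (map (\<lambda>t k. eval_trm M (\<lambda>x. \<sigma> x k) t) ts)"
    by (simp add: eval_upower)
  then have "sat (upower M) (\<lambda>x. cls (\<sigma> x)) (Rel r ts)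
      \<longleftrightarrow> rint (upower M) r (map cls (map (\<lambda>t k. eval_trm M (\<lambda>x. \<sigma> x k) t) ts))"
    by (simp only: sat.simps)
  then show ?case by (simp only: rint_upower) (simp add: comp_def)
next
  case (Neg \<phi>)
  then show ?case by (simp add: often_not)
next
  case (Conj I F)
  then show ?case by (simp add: often_ball[OF assms(1)])
next
  case (Exists X \<phi>)
  have in_L: "in_L V \<mu> \<nu> \<phi>" using Exists.prems by simp
  show ?case
  proof
    assume "sat (upower M) (\<lambda>x. cls (\<sigma> x)) (Exists X \<phi>)"
    then obtain s where s: "\<And>x. x \<in> X \<Longrightarrow> s x \<in> univ (upower M)"
        "\<And>x. x \<notin> X \<Longrightarrow> s x = cls (\<sigma> x)" "sat (upower M) s \<phi>"
      by auto
    \<comment> \<open>Off \<open>X\<close> the representative must be \<open>\<sigma> x\<close>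
      itself: at each coordinate the new assignment has to agree with the old one exactly, not just
      modulo \<open>U\<close>.\<close>
    have "\<exists>f. range f \<subseteq> univ M \<and> s x = cls f \<and> (x \<notin> X \<longrightarrow> f = \<sigma> x)" for x
      using s(1,2)[of x] Exists.prems(2)[of x] by (cases "x \<in> X") (auto simp: upower_def)
    then obtain \<tau> where \<tau>: "\<And>x. range (\<tau> x) \<subseteq> univ M" "\<And>x. s x = cls (\<tau> x)"
        "\<And>x. x \<notin> X \<Longrightarrow> \<tau> x = \<sigma> x"
      by metis
    have "s = (\<lambda>x. cls (\<tau> x))" using \<tau>(2) by auto
    then have "often (\<lambda>k. sat M (\<lambda>x. \<tau> x k) \<phi>)"
      using Exists.IH[OF in_L \<tau>(1)] s(3) by simp
    then show "often (\<lambda>k. sat M (\<lambda>x. \<sigma> x k) (Exists X \<phi>))"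
    proof (rule often_mono)
      fix k assume "sat M (\<lambda>x. \<tau> x k) \<phi>"
      then show "sat M (\<lambda>x. \<sigma> x k) (Exists X \<phi>)"
        using \<tau>(1,3) by (auto intro!: exI[of _ "\<lambda>x. \<tau> x k"])
    qed
  next
    assume *: "often (\<lambda>k. sat M (\<lambda>x. \<sigma> x k) (Exists X \<phi>))"
    \<comment> \<open>Where the existential formula fails, \<open>\<sigma>\<close> at
      \<open>k\<close> serves as default. Thus a witness \<open>w k\<close> exists for every
      \<open>k\<close>, and \<open>\<lambda>k. w k x\<close> represents the value of
      \<open>x\<close> in the ultrapower.\<close>
    have "\<exists>s. (\<forall>x\<in>X. s x \<in> univ M) \<and> (\<forall>x. x \<notin> X \<longrightarrow> s x = \<sigma> x k) \<and>
        (sat M (\<lambda>x. \<sigma> x k) (Exists X \<phi>) \<longrightarrow> sat M s \<phi>)" for k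
    proof (cases "sat M (\<lambda>x. \<sigma> x k) (Exists X \<phi>)")
      case False
      then show ?thesis
        using Exists.prems(2) by (intro exI[of _ "\<lambda>x. \<sigma> x k"]) blast
    qed auto
    then obtain w where w: "\<And>k x. x \<in> X \<Longrightarrow> w k x \<in> univ M" "\<And>k x. x \<notin> X \<Longrightarrow> w k x = \<sigma> x k"
        "\<And>k. sat M (\<lambda>x. \<sigma> x k) (Exists X \<phi>) \<Longrightarrow> sat M (w k) \<phi>"
      by metis
    have range: "range (\<lambda>k. w k x) \<subseteq> univ M" for x
      using w(1,2) Exists.prems(2)[of x] by (cases "x \<in> X") auto
    have "often (\<lambda>k. sat M (\<lambda>x. w k x) \<phi>)"
      using * by (rule often_mono) (rule w(3))
    then have "sat (upower M) (\<lambda>x. cls (\<lambda>k. w k x)) \<phi>"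
      using Exists.IH[OF in_L range] by simp
    moreover have "cls (\<lambda>k. w k x) \<in> univ (upower M)" for x
      using range by (simp add: upower_def)
    ultimately show "sat (upower M) (\<lambda>x. cls (\<sigma> x)) (Exists X \<phi>)"
      using w(2) by (auto intro!: exI[of _ "\<lambda>x. cls (\<lambda>k. w k x)"])
  qed
qed

section \<open>The ultrapower as a proper extension satisfying the same sentence\<close>

lemma Inl_in_upower: "a \<in> univ M \<Longrightarrow> Inl a \<in> univ (upower M)"
  unfolding upower_def by (auto simp flip: cls_const)

lemma is_struct_upower:
  assumes "is_struct V M"
  shows "is_struct V (upower M)"
  unfolding is_struct_def
proof (intro conjI ballI impI)
  show "univ (upower M) \<noteq> {}"
    using assms Inl_in_upower by (fastforce simp: is_struct_def)
next
  fix f ys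
  assume f: "f \<in> funs V" and ys: "ys \<in> lists (univ (upower M))" "length ys = far V f"
  then obtain gs where gs: "ys = map cls gs" "gs \<in> lists {f. range f \<subseteq> univ M}"
    by (auto simp: upower_def lists_image)
  have "fint M f (map (\<lambda>g. g k) gs) \<in> univ M" for k
  proof -
    have "map (\<lambda>g. g k) gs \<in> lists (univ M)" using gs(2) by (auto simp: image_subset_iff)
    then show ?thesis using assms f ys(2) gs(1) by (auto simp: is_struct_def)
  qed
  then show "fint (upower M) f ys \<in> univ (upower M)"
    unfolding gs(1) fint_upower by (auto simp: upower_def)
qed

lemma is_model_upower:
  fixes \<phi> :: "('f, 'r, 'i, 'v) fml" and M :: "('f, 'r, 'a) struct"
  assumes "complete_family \<mu> U" and "in_L V \<mu> \<nu> \<phi>" and "is_model V \<phi> M"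
  shows "is_model V \<phi> (upower M)"
  unfolding is_model_def
proof (intro conjI allI impI)
  show "is_struct V (upower M)" using assms(3) by (simp add: is_model_def is_struct_upower)
next
  fix s :: "'v \<Rightarrow> 'a + ('k \<Rightarrow> 'a)"
  assume "range s \<subseteq> univ (upower M)"
  then have "s x \<in> univ (upower M)" for x by auto
  then have "\<exists>f. range f \<subseteq> univ M \<and> s x = cls f" for x
    by (auto simp: upower_def image_iff)
  then obtain \<sigma> where \<sigma>: "\<And>x. range (\<sigma> x) \<subseteq> univ M" "\<And>x. s x = cls (\<sigma> x)"
    by metis
  \<comment> \<open>Each coordinate of \<open>\<sigma>\<close> is an assignment into the model
    \<open>M\<close>, so the right-hand side of \<open>Los\<close> holds at every
    \<open>k\<close>.\<close>
  have "sat M (\<lambda>x. \<sigma> x k) \<phi>" for k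
  proof -
    have "range (\<lambda>x. \<sigma> x k) \<subseteq> univ M" using \<sigma>(1) by blast
    then show ?thesis using assms(3) by (simp add: is_model_def)
  qed
  moreover have "s = (\<lambda>x. cls (\<sigma> x))" using \<sigma>(2) by auto
  ultimately show "sat (upower M) s \<phi>"
    using Los[OF assms(1,2) \<sigma>(1)] by simp
qed

text \<open>\<open>rep\<close> sends \<open>Inl a\<close> to a constant function, so on the diagonal
  \<open>cls_const\<close> and \<open>often_const\<close> return the values in
  \<open>M\<close>.\<close>

lemma substruct_upower:
  fixes M :: "('f, 'r, 'a) struct"
  assumes "is_struct V M"
  shows "substruct V (inl_copy M) (upower M)"
proof -
  have "is_struct V (inl_copy M :: ('f, 'r, 'a + ('k \<Rightarrow> 'a)) struct)"
    using assms by (auto simp: is_struct_def inl_copy_def lists_image comp_def)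
  moreover have "univ (inl_copy M) \<subseteq> univ (upower M)"
    by (auto simp: inl_copy_def Inl_in_upower)
  moreover have "fint (inl_copy M) f xs = fint (upower M) f xs"
      and "rint (inl_copy M) r xs = rint (upower M) r xs"
    if "xs \<in> lists (univ (inl_copy M))" for f r and xs :: "('a + ('k \<Rightarrow> 'a)) list"
    using that by (auto simp: inl_copy_def upower_def lists_image comp_def)
  ultimately show ?thesis
    using is_struct_upower[OF assms] by (simp add: substruct_def)
qed

lemma upower_proper:
  assumes "nonprincipal_on S U" and "inj_on h S" and "h ` S \<subseteq> univ M" and "univ M \<noteq> {}"
  shows "univ (inl_copy M) \<noteq> univ (upower M)"
proof -
  obtain a where a: "a \<in> univ M" using assms(4) by auto
  \<comment> \<open>Elements of the ultrapower come from functions on the whole type, so the value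
    \<open>a\<close> off \<open>S\<close> keeps the range inside \<open>univ M\<close>.\<close>
  define g where "g k = (if k \<in> S then h k else a)" for k
  have "cls g \<in> univ (upower M)"
    using a assms(3) by (auto simp: upower_def g_def intro!: imageI)
  moreover have "cls g \<noteq> Inl b" for b
  proof
    assume "cls g = Inl b"
    then have "cls g = cls (\<lambda>_. b)" by simp
    then have *: "often (\<lambda>k. g k = b)" unfolding cls_eq_iff ueq_def .
    then obtain k where k: "k \<in> S" "g k = b" using often_ex by blast
    \<comment> \<open>By injectivity, agreement with a constant would put a singleton into
      \<open>U\<close>.\<close>
    then have "{k\<in>S. g k = b} = {k}"
      using assms(2) by (auto simp: g_def inj_on_def)
    then show False
      using * k(1) assms(1) by (simp add: often_def nonprincipal_on_def)
  qed
  ultimately show ?thesis by (auto simp: inl_copy_def)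
qed

end

section \<open>Comparison of infinitary languages and the conclusion\<close>

lemma in_L_mono:
  assumes "in_L V \<kappa> \<nu> \<phi>" and "\<kappa> \<le>o \<kappa>'" and "\<nu> \<le>o \<nu>'"
  shows "in_L V \<kappa>' \<nu>' \<phi>"
  using assms(1) by (induction \<phi>) (auto intro: ordLess_ordLeq_trans assms(2,3))

text \<open>The type \<open>'k \<Rightarrow> 'a\<close> houses the classes without a constant
  member. The second conjunct brings sentences of
  \<open>L\<^sub>\<omega>\<^sub>1\<^sub>\<omega>\<close> under the first.\<close>

theorem lemma3p0p2:
  fixes \<mu> :: "'k rel" and V :: "('f, 'r) vocab"
  assumes "measurable_cardinal \<mu>"
  shows "(\<forall>\<phi> :: ('f, 'r, 'i, 'v) fml. sentence_L V \<mu> \<mu> \<phi> \<longrightarrow>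
            (\<forall>M :: ('f, 'r, 'a) struct. is_model V \<phi> M \<and> \<mu> \<le>o |univ M| \<longrightarrow>
               \<not> maximal_model TYPE('k \<Rightarrow> 'a) V \<phi> M)) \<and>
         (\<forall>\<phi> :: ('f, 'r, 'i, 'v) fml. sentence_L V (cardSuc natLeq) natLeq \<phi> \<longrightarrow>
            sentence_L V \<mu> \<mu> \<phi>)"
proof (intro conjI allI impI)
  fix \<phi> :: "('f, 'r, 'i, 'v) fml" and M :: "('f, 'r, 'a) struct"
  assume \<phi>: "sentence_L V \<mu> \<mu> \<phi>" and M: "is_model V \<phi> M \<and> \<mu> \<le>o |univ M|"
  obtain U where U: "ultrafilter_on (Field \<mu>) U" "nonprincipal_on (Field \<mu>) U"
      "complete_family \<mu> U" and \<mu>: "Card_order \<mu>"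
    using assms by (auto simp: measurable_cardinal_def)
  interpret ultrafilter "Field \<mu>" U by unfold_locales (rule U(1))
  have "|Field \<mu>| \<le>o |univ M|"
    using card_of_Field_ordIso[OF \<mu>] M by (blast intro: ordIso_ordLeq_trans)
  then obtain h where h: "inj_on h (Field \<mu>)" "h ` Field \<mu> \<subseteq> univ M"
    unfolding card_of_ordLeq[symmetric] by blast
  have struct: "is_struct V M" using M by (simp add: is_model_def)
  then have "univ M \<noteq> {}" by (simp add: is_struct_def)
  then have "proper_substruct V (inl_copy M) (upower M)"
    unfolding proper_substruct_def
    using substruct_upower[OF struct] upower_proper[OF U(2) h] by simp
  moreover have "is_model V \<phi> (upower M)"
    using is_model_upower[OF U(3)] \<phi> M by (auto simp: sentence_L_def)
  ultimately show "\<not> maximal_model TYPE('k \<Rightarrow> 'a) V \<phi> M"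
    by (auto simp: maximal_model_def)
next
  fix \<phi> :: "('f, 'r, 'i, 'v) fml"
  assume "sentence_L V (cardSuc natLeq) natLeq \<phi>"
  \<comment> \<open>Measurability includes uncountability, so \<open>\<mu>\<close> is at least the
    successor of \<open>natLeq\<close>.\<close>
  moreover have "cardSuc natLeq \<le>o \<mu>" and "natLeq \<le>o \<mu>"
    using assms natLeq_Card_order
    by (auto simp: measurable_cardinal_def intro: cardSuc_least ordLess_imp_ordLeq)
  ultimately show "sentence_L V \<mu> \<mu> \<phi>"
    by (auto simp: sentence_L_def intro: in_L_mono)
qed

end
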